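(* Let $n\ge 2$, let $a,b\in\mathbb{R}^n$ with $a\le b$, let $f:\mathbb{R}^n\to\mathbb{R}$ be increasing, let $\mathcal{G}\subset\mathbb{R}^n$ be closed and normal with $a\in\mathcal{G}$, let $\mathcal{H}\subset\mathbb{R}^n$ be closed and co-normal with $b\in\mathcal{H}$, and let $\epsilon>0$, $\delta>0$. Then every run of the $\delta$-relaxed POA algorithm with balanced anchors (defined in the context) terminates in no more than $$\frac{n^{D}-1}{n-1},\qquad D:=\lfloor \delta^{-1}\|b-a\|_1\rfloor+1,$$ iterations, and it either returns a $\delta$-relaxed $\epsilon$-optimal solution, or returns NULL, in which case $\mathcal{F}_\delta=\emptyset$.
   Context: Notation. For $x,y\in\mathbb{R}^n$: $x\le y$ means $x_i\le y_i$ for all $i$; $x<y$ means $x_i<y_i$ for all $i$; $[x,y]=\prod_i[x_i,y_i]$; $[x,\infty)=\{w:w\ge x\}$; $(x,\infty)=\{w:w>x\}$; $P(x)=\{w:w\le x\}$, and $P(S)=\bigcup_{x\in S}P(x)$ for $S\subset\mathbb{R}^n$. $\mathbf{1}$ is the all-ones vector and $[n]=\{1,\dots,n\}$. $\varrho_i(u,v)$ denotes the vector obtained from $u$ by replacing its $i$-th component by $v_i$. $f$ is increasing if $x\le y$ implies $f(x)\le f(y)$. A set $S$ is normal if $x\in S$ implies $P(x)\subset S$; it is co-normal if $x\in S$ implies $[x,\infty)\subset S$. Problem: maximise $f(x)$ over $\mathcal{F}:=\mathcal{G}\cap\mathcal{H}\cap[a,b]$. Relaxation. $\mathcal{G}_\delta:=\{x\in\mathcal{G}: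 \{x+v:\|v\|_\infty\le\delta\}\subset\mathcal{G}\}$ (equivalently $x+\delta\mathbf{1}\in\mathcal{G}$), and $\mathcal{F}_\delta:=\mathcal{G}_\delta\cap\mathcal{H}\cap[a,b]$. A point $x^\star$ is a $\delta$-relaxed $\epsilon$-optimal solution if $x^\star\in\mathcal{F}$ and $f(x^\star)+\epsilon>f(x)$ for all $x\in\mathcal{F}_\delta$. Projection. For $y\in\mathcal{G}_\delta$ and $x>y$, $\pi_{\mathcal{G}_\delta}(x;y):=rx+(1-r)y$ with $r=\sup\{r\in[0,1]: rx+(1-r)y\in\mathcal{G}_\delta\}$. The $\delta$-relaxed POA algorithm with balanced anchors. Start with $V^0=\{b\}$, incumbent $\hat z=$ NULL, incumbent value $\hat f^0=-\infty$. While $V^t\ne\emptyset$, perform iteration $t$ ($t=0,1,2,\dots$): (1) choose any $\hat x^t\in\arg\max_{x\in V^t}f(x)$ (the maximal vertex); (2) set $y^t=\hat x^t-(\|\hat x^t-a\|_\infty+\delta)\mathbf{1}$, $z^t=\pi_{\mathcal{G}_\delta}(\hat x^t;y^t)$ (projections are computed exactly), and $c^t=\min(z^t+\delta\mathbf{1},b)$ (componentwise minimum); (3) if $f(c^t)>\hat f^t$ and $c^t\in\mathcal{H}\cap[a,b]$, set $\hat z=c^t$ and $\hat f^{t+1}=f(c^t)$; otherwise keep $\hat z$ and set $\hat f^{t+1}=\hat f^t$; (4) set $I^t_\delta=V^t\cap(z^t+\delta\mathbf{1},\infty)$, $F^t_\delta=V^t\setminus I^t_\delta$, $\bar I^t=V^t\cap[z^t,\infty)$,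 $$W^t=\{\varrho_i(s,z^t): s\in I^t_\delta,\ i\in[n],\ \varrho_i(s,z^t)\notin P(\bar I^t\setminus\{s\})\},\qquad N^t=W^t\cap\mathcal{H}\cap[a,b],$$ and $V^{t+1}=\{s\in F^t_\delta\cup N^t: f(s)\ge\hat f^{t+1}+\epsilon\}$. When the loop ends, return $\hat z$. The number of iterations is the number of executions of the loop body (1)–(4). *)

theory Defs
  imports "HOL-Analysis.Analysis"
begin

(* On real ^ 'n the library order \<le> is the componentwise one and {x..y} is the box [x, y],
   but the library's x < y only means x \<le> y and x \<noteq> y. The relation "every component is
   strictly smaller" therefore needs its own name. *)
definition strictly_below :: "real ^ 'n \<Rightarrow> real ^ 'n \<Rightarrow> bool"
  where "strictly_below x y \<longleftrightarrow> (\<forall>i. x $ i < y $ i)"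

definition down_closure :: "(real ^ 'n) set \<Rightarrow> (real ^ 'n) set"
  where "down_closure S = (\<Union>x\<in>S. {..x})"

definition normal_set :: "(real ^ 'n) set \<Rightarrow> bool"
  where "normal_set S \<longleftrightarrow> (\<forall>x\<in>S. {..x} \<subseteq> S)"

definition conormal_set :: "(real ^ 'n) set \<Rightarrow> bool"
  where "conormal_set S \<longleftrightarrow> (\<forall>x\<in>S. {x..} \<subseteq> S)"

definition norm1 :: "real ^ 'n \<Rightarrow> real"
  where "norm1 x = (\<Sum>i\<in>UNIV. \<bar>x $ i\<bar>)"

(* u with its i-th component replaced by that of v *)
definition replace_comp :: "'n \<Rightarrow> real ^ 'n \<Rightarrow> real ^ 'n \<Rightarrow> real ^ 'n"
  where "replace_comp i u v = (\<chi> j. if j = i then v $ i else u $ j)"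

definition feasible ::
    "(real ^ 'n) set \<Rightarrow> (real ^ 'n) set \<Rightarrow> real ^ 'n \<Rightarrow> real ^ 'n \<Rightarrow> (real ^ 'n) set"
  where "feasible G H a b = G \<inter> H \<inter> {a..b}"

definition relaxed :: "real \<Rightarrow> (real ^ 'n) set \<Rightarrow> (real ^ 'n) set"
  where "relaxed \<delta> G = {x \<in> G. {x + v | v. infnorm v \<le> \<delta>} \<subseteq> G}"

definition relaxed_optimal ::
    "(real ^ 'n \<Rightarrow> real) \<Rightarrow> (real ^ 'n) set \<Rightarrow> (real ^ 'n) set \<Rightarrow> real ^ 'n \<Rightarrow> real ^ 'n \<Rightarrow>
     real \<Rightarrow> real \<Rightarrow> real ^ 'n \<Rightarrow> bool"
  where "relaxed_optimal f G H a b \<epsilon> \<delta> x \<longleftrightarrow>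
    x \<in> feasible G H a b \<and> (\<forall>x'\<in>feasible (relaxed \<delta> G) H a b. f x + \<epsilon> > f x')"

(* Only meaningful for y \<in> S with y strictly below x; the set of parameters then contains 0
   and is bounded, so Sup is its supremum. *)
definition projection :: "(real ^ 'n) set \<Rightarrow> real ^ 'n \<Rightarrow> real ^ 'n \<Rightarrow> real ^ 'n"
  where "projection S x y =
    (let r = Sup {r \<in> {0..1}. r *\<^sub>R x + (1 - r) *\<^sub>R y \<in> S} in r *\<^sub>R x + (1 - r) *\<^sub>R y)"

(* Vertex set V, incumbent z (None is NULL) and incumbent value (initially -\<infinity>). *)
record ('n::finite) poa_state =
  vertices :: "(real ^ 'n) set"
  incumbent :: "(real ^ 'n) option"
  incumbent_value :: ereal

definition poa_init :: "real ^ 'n \<Rightarrow> 'n poa_state"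
  where "poa_init b = \<lparr>vertices = {b}, incumbent = None, incumbent_value = - \<infinity>\<rparr>"

(* The anchored projection of the maximal vertex x; recall that 1 is the all-ones vector. *)
definition poa_point ::
    "(real ^ 'n) set \<Rightarrow> real ^ 'n \<Rightarrow> real \<Rightarrow> real ^ 'n \<Rightarrow> real ^ 'n"
  where "poa_point G a \<delta> x = projection (relaxed \<delta> G) x (x - (infnorm (x - a) + \<delta>) *\<^sub>R 1)"

definition poa_candidate :: "real ^ 'n \<Rightarrow> real \<Rightarrow> real ^ 'n \<Rightarrow> real ^ 'n"
  where "poa_candidate b \<delta> z = (\<chi> i. min ((z + \<delta> *\<^sub>R 1) $ i) (b $ i))"

definition poa_infeasible :: "real \<Rightarrow> (real ^ 'n) set \<Rightarrow> real ^ 'n \<Rightarrow> (real ^ 'n) set"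
  where "poa_infeasible \<delta> V z = {s \<in> V. strictly_below (z + \<delta> *\<^sub>R 1) s}"

definition poa_new_vertices :: "real \<Rightarrow> (real ^ 'n) set \<Rightarrow> real ^ 'n \<Rightarrow> (real ^ 'n) set"
  where "poa_new_vertices \<delta> V z =
    {replace_comp i s z | s i.
       s \<in> poa_infeasible \<delta> V z \<and> replace_comp i s z \<notin> down_closure ((V \<inter> {z..}) - {s})}"

(* The loop body after the maximal vertex x has been chosen. *)
definition poa_update ::
    "(real ^ 'n \<Rightarrow> real) \<Rightarrow> (real ^ 'n) set \<Rightarrow> (real ^ 'n) set \<Rightarrow> real ^ 'n \<Rightarrow> real ^ 'n \<Rightarrow>
     real \<Rightarrow> real \<Rightarrow> real ^ 'n \<Rightarrow> 'n poa_state \<Rightarrow> 'n poa_state"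
  where "poa_update f G H a b \<epsilon> \<delta> x s =
    (let V = vertices s;
         z = poa_point G a \<delta> x;
         c = poa_candidate b \<delta> z;
         improve = (ereal (f c) > incumbent_value s \<and> c \<in> H \<inter> {a..b});
         val = (if improve then ereal (f c) else incumbent_value s);
         F = V - poa_infeasible \<delta> V z;
         N = poa_new_vertices \<delta> V z \<inter> H \<inter> {a..b}
     in \<lparr>vertices = {v \<in> F \<union> N. ereal (f v) \<ge> val + ereal \<epsilon>},
         incumbent = (if improve then Some c else incumbent s),
         incumbent_value = val\<rparr>)"

(* One execution of the loop body. It is a relation because any maximiser may be chosen;
   since V is required to contain the maximiser, the loop guard V \<noteq> {} is implied. *)
definition poa_step ::
    "(real ^ 'n \<Rightarrow> real) \<Rightarrow> (real ^ 'n) set \<Rightarrow> (real ^ 'n) set \<Rightarrow> real ^ 'n \<Rightarrow> real ^ 'n \<Rightarrow>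
     real \<Rightarrow> real \<Rightarrow> 'n poa_state \<Rightarrow> 'n poa_state \<Rightarrow> bool"
  where "poa_step f G H a b \<epsilon> \<delta> s s' \<longleftrightarrow>
    (\<exists>x. is_arg_max f (\<lambda>v. v \<in> vertices s) x \<and> s' = poa_update f G H a b \<epsilon> \<delta> x s)"

(* The state s can be reached by exactly k iterations from the initial state. *)
definition poa_reaches ::
    "(real ^ 'n \<Rightarrow> real) \<Rightarrow> (real ^ 'n) set \<Rightarrow> (real ^ 'n) set \<Rightarrow> real ^ 'n \<Rightarrow> real ^ 'n \<Rightarrow>
     real \<Rightarrow> real \<Rightarrow> nat \<Rightarrow> 'n poa_state \<Rightarrow> bool"
  where "poa_reaches f G H a b \<epsilon> \<delta> k s \<longleftrightarrow>
    (poa_step f G H a b \<epsilon> \<delta> ^^ k) (poa_init b) s"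

end

(* If the projected point z is within \<delta> of the maximal vertex x, then the candidate dominates x,
   so its value prunes every vertex. Otherwise x itself is infeasible and is replaced by at most n
   children inside the box, each closer to a by more than \<delta> in the 1-norm. Weighting a vertex v
   with the size of a complete n-ary tree of depth \<lfloor>|v - a|_1 / \<delta>\<rfloor>, the total weight of the
   vertices thus drops in every iteration, and initially it is (n^D - 1) / (n - 1).
   For correctness, no relaxed feasible point exceeds z in all components, so every such point
   below an infeasible vertex stays below one of its children. That the dominated children can be
   discarded relies on the vertices forming an antichain. *)
theory Submission
  imports Defs
begin

section \<open>Component replacement, relaxation and tree weights\<close>

lemma replace_comp_nth [simp]: "replace_comp i u v $ j = (if j = i then v $ i else u $ j)"
  by (simp add: replace_comp_def)

text \<open>The point \<open>x + \<delta> *\<^sub>R 1\<close> is the greatest element of the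
  max-norm ball around \<open>x\<close>, so by normality it decides for the whole ball.\<close>

lemma relaxed_iff:
  fixes G :: "(real ^ 'n) set"
  assumes "normal_set G" and "0 \<le> \<delta>"
  shows "x \<in> relaxed \<delta> G \<longleftrightarrow> x + \<delta> *\<^sub>R 1 \<in> G"
proof
  assume "x \<in> relaxed \<delta> G"
  moreover have "infnorm (\<delta> *\<^sub>R (1 :: real ^ 'n)) \<le> \<delta>"
    using assms(2) by (auto simp: infnorm_Max Max_le_iff Basis_vec_def inner_axis)
  ultimately show "x + \<delta> *\<^sub>R 1 \<in> G"
    by (auto simp: relaxed_def)
next
  assume "x + \<delta> *\<^sub>R 1 \<in> G"
  then have *: "w \<in> G" if "w \<le> x + \<delta> *\<^sub>R 1" for w
    using assms(1) that by (auto simp: normal_set_def)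
  have "x + v \<in> G" if "infnorm v \<le> \<delta>" for v
  proof (rule *)
    have "v $ i \<le> \<delta>" for i
      using component_le_infnorm_cart[of v i] that by linarith
    then show "x + v \<le> x + \<delta> *\<^sub>R 1"
      by (simp add: less_eq_vec_def)
  qed
  moreover have "x \<in> G"
    using assms(2) by (intro *) (simp add: less_eq_vec_def)
  ultimately show "x \<in> relaxed \<delta> G"
    by (auto simp: relaxed_def)
qed

lemma norm1_replace_comp:
  assumes "a \<le> s" and "a $ i \<le> z $ i"
  shows "norm1 (replace_comp i s z - a) = norm1 (s - a) - (s $ i - z $ i)"
proof -
  have "norm1 (replace_comp i s z - a) =
      (\<Sum>j\<in>UNIV. \<bar>s $ j - a $ j\<bar> - (if j = i then s $ i - z $ i else 0))"
    unfolding norm1_def using assms by (intro sum.cong) (auto simp: less_eq_vec_def)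
  then show ?thesis
    by (simp add: sum_subtractf norm1_def)
qed

(* The number of nodes of the complete n-ary tree of depth \<lfloor>|x - a|_1 / \<delta>\<rfloor>. *)
definition poa_weight :: "real ^ 'n \<Rightarrow> real \<Rightarrow> real ^ 'n \<Rightarrow> nat"
  where "poa_weight a \<delta> x = (\<Sum>j<Suc (nat \<lfloor>norm1 (x - a) / \<delta>\<rfloor>). CARD('n) ^ j)"

lemma poa_weight_pos: "0 < poa_weight a \<delta> x"
  unfolding poa_weight_def by (subst sum.lessThan_Suc_shift) simp

text \<open>Losing \<delta> in the 1-norm lowers the tree depth by at least one, so
  \<open>CARD('n)\<close> trees of the child's depth fit below the root of the parent's tree. The
  root makes the inequality strict.\<close>

lemma poa_weight_child:
  fixes a :: "real ^ 'n"
  assumes "0 < \<delta>" and "norm1 (w - a) \<le> norm1 (s - a) - \<delta>"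
  shows "CARD('n) * poa_weight a \<delta> w < poa_weight a \<delta> s"
proof -
  have w: "0 \<le> norm1 (w - a)"
    by (simp add: norm1_def sum_nonneg)
  have "(norm1 (w - a) + \<delta>) / \<delta> \<le> norm1 (s - a) / \<delta>"
    using assms by (intro divide_right_mono) auto
  then have "norm1 (w - a) / \<delta> + 1 \<le> norm1 (s - a) / \<delta>"
    using assms(1) by (simp add: add_divide_distrib)
  then have "\<lfloor>norm1 (w - a) / \<delta>\<rfloor> + 1 \<le> \<lfloor>norm1 (s - a) / \<delta>\<rfloor>"
    by linarith
  moreover have "0 \<le> \<lfloor>norm1 (w - a) / \<delta>\<rfloor>"
    using w assms(1) by simp
  ultimately have "Suc (nat \<lfloor>norm1 (w - a) / \<delta>\<rfloor>) \<le> nat \<lfloor>norm1 (s - a) / \<delta>\<rfloor>"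
    by linarith
  then have "poa_weight a \<delta> w \<le> (\<Sum>j<nat \<lfloor>norm1 (s - a) / \<delta>\<rfloor>. CARD('n) ^ j)"
    unfolding poa_weight_def by (intro sum_mono2) auto
  then have "CARD('n) * poa_weight a \<delta> w \<le> (\<Sum>j<nat \<lfloor>norm1 (s - a) / \<delta>\<rfloor>. CARD('n) ^ Suc j)"
    by (simp flip: sum_distrib_left)
  also have "\<dots> < poa_weight a \<delta> s"
    unfolding poa_weight_def by (subst sum.lessThan_Suc_shift) simp
  finally show ?thesis .
qed

lemma sum_UN_le:
  fixes g :: "'a \<Rightarrow> nat"
  assumes "finite I" and "\<And>i. i \<in> I \<Longrightarrow> finite (A i)"
  shows "sum g (\<Union>i\<in>I. A i) \<le> (\<Sum>i\<in>I. sum g (A i))"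
  using assms
proof (induction I)
  case (insert i I)
  have "sum g (A i \<union> (\<Union>i\<in>I. A i)) \<le> sum g (A i) + sum g (\<Union>i\<in>I. A i)"
    using insert by (subst sum_Un_nat) auto
  with insert show ?case
    by force
qed simp

lemma finite_is_arg_max:
  fixes f :: "'a \<Rightarrow> 'b::linorder"
  assumes "finite S" and "S \<noteq> {}"
  shows "\<exists>x. is_arg_max f (\<lambda>v. v \<in> S) x"
proof -
  have "Max (f ` S) \<in> f ` S"
    using assms by (intro Max_in) auto
  then obtain x where "x \<in> S" "f x = Max (f ` S)"
    by force
  then show ?thesis
    using assms(1) by (auto simp: is_arg_max_def not_less intro!: exI[of _ x])
qed

section \<open>Standing assumptions and the anchored projection\<close>

locale poa =
  fixes a b :: "real ^ 'n" and f :: "real ^ 'n \<Rightarrow> real" and G H :: "(real ^ 'n) set"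
    and \<epsilon> \<delta> :: real
  assumes a_le_b: "a \<le> b"
    and mono_f: "mono f"
    and closed_G: "closed G" and normal_G: "normal_set G" and a_in_G: "a \<in> G"
    and conormal_H: "conormal_set H" and b_in_H: "b \<in> H"
    and eps_pos: "\<epsilon> > 0" and delta_pos: "\<delta> > 0"
begin

lemma in_GI: "x \<in> G \<Longrightarrow> y \<le> x \<Longrightarrow> y \<in> G"
  using normal_G by (auto simp: normal_set_def)

lemma in_HI: "x \<in> H \<Longrightarrow> x \<le> y \<Longrightarrow> y \<in> H"
  using conormal_H by (auto simp: conormal_set_def)

text \<open>The anchor differs from \<open>x\<close> by a multiple of the all-ones vector, so the
  projection lowers all components by the same amount \<tau>. If \<tau> is positive, a relaxed point
  above the projection in every component would permit a larger ray parameter.\<close>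

lemma poa_point_cases:
  assumes "a \<le> x"
  obtains \<tau> where "0 \<le> \<tau>" and "poa_point G a \<delta> x = x - \<tau> *\<^sub>R 1"
    and "poa_point G a \<delta> x + \<delta> *\<^sub>R 1 \<in> G"
    and "\<tau> = 0 \<or> (\<forall>w\<in>relaxed \<delta> G. \<exists>i. w $ i \<le> poa_point G a \<delta> x $ i)"
proof -
  define m where "m = infnorm (x - a) + \<delta>"
  \<comment> \<open>The point of the ray with parameter \<open>r\<close>, already shifted by
    \<open>\<delta> *\<^sub>R 1\<close>: membership in the relaxed set becomes
    \<open>p r \<in> G\<close>.\<close>
  define p where "p r = x + (\<delta> - (1 - r) * m) *\<^sub>R (1 :: real ^ 'n)" for r
  define S where "S = {r \<in> {0..1}. p r \<in> G}"
  define r where "r = Sup S"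
  have m: "m > 0"
    using delta_pos infnorm_pos_le[of "x - a"] by (simp add: m_def)
  have ray: "r *\<^sub>R x + (1 - r) *\<^sub>R (x - m *\<^sub>R 1) + \<delta> *\<^sub>R 1 = p r" for r
    by (simp add: p_def vec_eq_iff algebra_simps)
  have S_eq: "{r \<in> {0..1}. r *\<^sub>R x + (1 - r) *\<^sub>R (x - m *\<^sub>R 1) \<in> relaxed \<delta> G} = S"
    using delta_pos by (simp add: S_def relaxed_iff normal_G ray)
  \<comment> \<open>The anchor distance is chosen for this: \<open>p 0\<close> is
    \<open>x - infnorm (x - a) *\<^sub>R 1\<close>, so the parameter 0 is admissible.\<close>
  have "p 0 \<le> a"
    unfolding less_eq_vec_def
  proof
    fix i
    show "p 0 $ i \<le> a $ i"
      using component_le_infnorm_cart[of "x - a" i] by (simp add: p_def m_def)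
  qed
  then have "0 \<in> S"
    using in_GI a_in_G by (auto simp: S_def)
  \<comment> \<open>Closedness makes the supremum attained, so the projection itself lies in the
    relaxed set.\<close>
  moreover have "closed S"
  proof -
    have "S = {0..1} \<inter> p -` G"
      by (auto simp: S_def)
    moreover have "closed (p -` G)"
      unfolding p_def by (intro closed_vimage closed_G continuous_intros)
    ultimately show ?thesis
      by auto
  qed
  moreover have bdd: "bdd_above S"
    by (auto simp: S_def bdd_above_def)
  ultimately have r: "r \<in> S"
    unfolding r_def using closed_contains_Sup by blast
  have z_eq: "poa_point G a \<delta> x = r *\<^sub>R x + (1 - r) *\<^sub>R (x - m *\<^sub>R 1)"
    unfolding poa_point_def projection_def m_def[symmetric] S_eq r_def by (simp add: Let_def)
  have max: "\<exists>i. w $ i \<le> poa_point G a \<delta> x $ i"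
    if "(1 - r) * m \<noteq> 0" and w: "w \<in> relaxed \<delta> G" for w
  proof (rule ccontr)
    assume neg: "\<nexists>i. w $ i \<le> poa_point G a \<delta> x $ i"
    define d where "d = Min (range (\<lambda>i. w $ i - poa_point G a \<delta> x $ i))"
    have "d > 0"
      using neg by (auto simp: d_def not_le)
    have d: "d \<le> w $ i - poa_point G a \<delta> x $ i" for i
      by (simp add: d_def)
    \<comment> \<open>The ray parameter can grow by \<open>e\<close>: the bound \<open>1 - r\<close>
      keeps it in the unit interval, and \<open>d / m\<close> keeps the diagonal shift within
      \<open>d\<close>, the smallest gap between \<open>w\<close> and the projection.\<close>
    define e where "e = min (1 - r) (d / m)"
    have "r < 1"
      using that r by (auto simp: S_def less_le)
    with \<open>d > 0\<close> m have e: "0 < e" "e \<le> 1 - r" "e * m \<le> d"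
      by (auto simp: e_def min_def field_simps)
    have "p (r + e) \<le> w + \<delta> *\<^sub>R 1"
      unfolding less_eq_vec_def
    proof
      fix i
      have "p (r + e) $ i = poa_point G a \<delta> x $ i + \<delta> + e * m"
        by (simp add: p_def z_eq algebra_simps)
      also have "\<dots> \<le> (w + \<delta> *\<^sub>R 1) $ i"
        using d[of i] e by simp
      finally show "p (r + e) $ i \<le> (w + \<delta> *\<^sub>R 1) $ i" .
    qed
    then have "p (r + e) \<in> G"
      using w in_GI delta_pos by (auto simp: relaxed_iff normal_G)
    then have "r + e \<in> S"
      using e r by (auto simp: S_def)
    then have "r + e \<le> r"
      unfolding r_def using bdd by (rule cSup_upper)
    then show False
      using e by simp
  qed
  show thesis
  proof (rule that[of "(1 - r) * m"])
    show "0 \<le> (1 - r) * m"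
      using m r by (simp add: S_def)
    show "poa_point G a \<delta> x = x - ((1 - r) * m) *\<^sub>R 1"
      by (simp add: z_eq vec_eq_iff algebra_simps)
    show "poa_point G a \<delta> x + \<delta> *\<^sub>R 1 \<in> G"
      using r by (simp add: z_eq ray S_def)
    show "(1 - r) * m = 0 \<or> (\<forall>w\<in>relaxed \<delta> G. \<exists>i. w $ i \<le> poa_point G a \<delta> x $ i)"
      using max by blast
  qed
qed

section \<open>Loop invariant and potential\<close>

text \<open>The covering clause carries correctness: a relaxed feasible point stays below some
  vertex until its value is beaten up to \<epsilon>. The antichain clause serves
  \<open>cover_update\<close>.\<close>

definition invariant :: "'n poa_state \<Rightarrow> bool"
  where "invariant s \<longleftrightarrow>
    finite (vertices s) \<and> vertices s \<subseteq> H \<inter> {a..b} \<and>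
    (\<forall>u\<in>vertices s. \<forall>v\<in>vertices s. u \<le> v \<longrightarrow> u = v) \<and>
    (\<forall>x\<in>feasible (relaxed \<delta> G) H a b.
       (\<exists>v\<in>vertices s. x \<le> v) \<or> ereal (f x) < incumbent_value s + ereal \<epsilon>) \<and>
    (case incumbent s of
       None \<Rightarrow> incumbent_value s = - \<infinity>
     | Some z \<Rightarrow> z \<in> feasible G H a b \<and> incumbent_value s = ereal (f z))"

definition potential :: "'n poa_state \<Rightarrow> nat"
  where "potential s = (\<Sum>v\<in>vertices s. poa_weight a \<delta> v)"

lemma invariant_init: "invariant (poa_init b)"
  using a_le_b b_in_H by (auto simp: invariant_def poa_init_def feasible_def)

lemma new_vertices_eq:
  "poa_new_vertices \<delta> V z = {replace_comp i s z | s i. s \<in> poa_infeasible \<delta> V z \<and>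
     (\<forall>s'\<in>V. z \<le> s' \<and> s' \<noteq> s \<longrightarrow> \<not> replace_comp i s z \<le> s')}"
  by (auto simp: poa_new_vertices_def down_closure_def)

section \<open>Preservation of the antichain and of the covering\<close>

lemma infeasibleD:
  assumes "s \<in> poa_infeasible \<delta> V z"
  shows "s \<in> V" and "z $ i + \<delta> < s $ i" and "z $ i < s $ i" and "z \<le> s"
    and "z \<le> replace_comp i s z" and "replace_comp i s z \<le> s"
proof -
  show "s \<in> V" and *: "z $ i + \<delta> < s $ i" for i
    using assms by (auto simp: poa_infeasible_def strictly_below_def)
  show **: "z $ i < s $ i" for i
    using *[of i] delta_pos by linarith
  show "z \<le> s" "z \<le> replace_comp i s z" "replace_comp i s z \<le> s"
    using ** by (auto simp: less_eq_vec_def intro: less_imp_le)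
qed

lemma finite_new_vertices:
  assumes "finite V"
  shows "finite (poa_new_vertices \<delta> V z)"
proof (rule finite_subset)
  show "poa_new_vertices \<delta> V z \<subseteq> (\<lambda>(s, i). replace_comp i s z) ` (V \<times> UNIV)"
    by (auto simp: new_vertices_eq dest: infeasibleD)
qed (use assms in simp)

text \<open>A point below a new vertex is also below its parent, where the domination test (for new
  \<open>u\<close>) or the old antichain (for old \<open>u\<close>) applies. Restriction to the box
  and pruning only pass to subsets, which stay antichains.\<close>

lemma antichain_update:
  assumes anti: "\<forall>u\<in>V. \<forall>v\<in>V. u \<le> v \<longrightarrow> u = v"
    and u: "u \<in> (V - poa_infeasible \<delta> V z) \<union> poa_new_vertices \<delta> V z"
    and v: "v \<in> (V - poa_infeasible \<delta> V z) \<union> poa_new_vertices \<delta> V z"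
    and "u \<le> v"
  shows "u = v"
proof (cases "u \<in> poa_new_vertices \<delta> V z")
  case True
  then obtain s i where s: "s \<in> poa_infeasible \<delta> V z" and u_eq: "u = replace_comp i s z"
    and undom: "\<And>s'. s' \<in> V \<Longrightarrow> z \<le> s' \<Longrightarrow> s' \<noteq> s \<Longrightarrow> \<not> u \<le> s'"
    by (auto simp: new_vertices_eq)
  have "z \<le> v"
    using infeasibleD(5)[OF s, of i] \<open>u \<le> v\<close> u_eq by simp
  show ?thesis
  proof (cases "v \<in> poa_new_vertices \<delta> V z")
    case True
    then obtain s' j where s': "s' \<in> poa_infeasible \<delta> V z" and v_eq: "v = replace_comp j s' z"
      by (auto simp: new_vertices_eq)
    have "u \<le> s'"
      using infeasibleD(6)[OF s', of j] \<open>u \<le> v\<close> v_eq by simp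
    then have "s' = s"
      using undom infeasibleD(1,4)[OF s'] by blast
    \<comment> \<open>At \<open>j\<close> the vertex \<open>v\<close> equals \<open>z\<close>,
      whereas \<open>u\<close> exceeds \<open>z\<close> strictly in every component but the replaced
      one; so \<open>u\<close> was replaced at \<open>j\<close> too.\<close>
    have "u $ j \<le> z $ j"
      using \<open>u \<le> v\<close> by (auto simp: less_eq_vec_def v_eq dest: spec[of _ j])
    then have "i = j"
      using infeasibleD(3)[OF s, of j] by (auto simp: u_eq split: if_splits)
    with \<open>s' = s\<close> show ?thesis
      by (simp add: u_eq v_eq)
  next
    case False
    with v have "v \<in> V" "v \<noteq> s"
      using s by auto
    with undom \<open>z \<le> v\<close> \<open>u \<le> v\<close> show ?thesis
      by blast
  qed
next
  case False
  with u have u: "u \<in> V" "u \<notin> poa_infeasible \<delta> V z"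
    by auto
  show ?thesis
  proof (cases "v \<in> poa_new_vertices \<delta> V z")
    case True
    then obtain s i where s: "s \<in> poa_infeasible \<delta> V z" and v_eq: "v = replace_comp i s z"
      by (auto simp: new_vertices_eq)
    have "u \<le> s"
      using infeasibleD(6)[OF s, of i] \<open>u \<le> v\<close> v_eq by simp
    with anti u s show ?thesis
      using infeasibleD(1)[OF s] by blast
  next
    case False
    with v anti u \<open>u \<le> v\<close> show ?thesis
      by blast
  qed
qed

(* Among the infeasible vertices above x take one that maximises the sum of the components
   other than i. In an antichain, any vertex dominating its i-th child would have a larger sum. *)
lemma cover_update:
  assumes "finite V" and V: "V \<subseteq> H \<inter> {a..b}"
    and anti: "\<forall>u\<in>V. \<forall>v\<in>V. u \<le> v \<longrightarrow> u = v"
    and x: "x \<in> H" "a \<le> x" and "x $ i \<le> z $ i" and "\<exists>v\<in>V. x \<le> v"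
  shows "\<exists>v\<in>(V - poa_infeasible \<delta> V z) \<union> (poa_new_vertices \<delta> V z \<inter> H \<inter> {a..b}). x \<le> v"
proof (rule ccontr)
  assume neg: "\<not> ?thesis"
  define A where "A = {v \<in> V. x \<le> v}"
  \<comment> \<open>Any other vertex above \<open>x\<close> would be kept and cover
    \<open>x\<close>.\<close>
  have A: "v \<in> poa_infeasible \<delta> V z" if "v \<in> A" for v
    using neg that by (auto simp: A_def)
  have "finite A" "A \<noteq> {}"
    using assms by (auto simp: A_def)
  define g where "g v = (\<Sum>k\<in>UNIV - {i}. v $ k)" for v :: "real ^ 'n"
  obtain s where "s \<in> A" and s_max: "\<And>v. v \<in> A \<Longrightarrow> g v \<le> g s"
    using finite_is_arg_max[OF \<open>finite A\<close> \<open>A \<noteq> {}\<close>, of g] by (auto simp: is_arg_max_def not_less)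
  then have s: "s \<in> poa_infeasible \<delta> V z" "s \<in> V" "x \<le> s"
    using A by (auto simp: A_def)
  have x_le: "x \<le> replace_comp i s z"
    using \<open>x \<le> s\<close> \<open>x $ i \<le> z $ i\<close> by (simp add: less_eq_vec_def)
  have "replace_comp i s z \<le> b"
    using infeasibleD(6)[OF s(1), of i] V s(2) by force
  then have "replace_comp i s z \<in> H \<inter> {a..b}"
    using x_le x in_HI by auto
  with neg x_le have "replace_comp i s z \<notin> poa_new_vertices \<delta> V z"
    by blast
  \<comment> \<open>The child lies in \<open>H\<close> and in the box, so only the domination test
    can have removed it.\<close>
  then obtain s' where s': "s' \<in> V" "s' \<noteq> s" and le: "replace_comp i s z \<le> s'"
    using s(1) by (auto simp: new_vertices_eq)
  have "s' \<in> A"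
    using s' le x_le by (auto simp: A_def)
  have le': "s $ k \<le> s' $ k" if "k \<noteq> i" for k
    using le that by (auto simp: less_eq_vec_def dest: spec[of _ k])
  have eq: "s $ k = s' $ k" if "k \<noteq> i" for k
  proof (rule ccontr)
    assume "s $ k \<noteq> s' $ k"
    then have "g s < g s'"
      unfolding g_def using le' that by (intro sum_strict_mono_ex1) (auto simp: less_le)
    with s_max[OF \<open>s' \<in> A\<close>] show False
      by simp
  qed
  \<comment> \<open>Vectors that agree outside \<open>i\<close> are comparable, which the antichain
    forbids for distinct vertices.\<close>
  have "s \<le> s' \<or> s' \<le> s"
    using eq linear[of "s $ i" "s' $ i"] unfolding less_eq_vec_def by (metis order_refl)
  with anti s s' show False
    by blast
qed

section \<open>Decrease of the potential\<close>

text \<open>Each infeasible vertex outweighs all its children together. A child shared by several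
  parents or equal to a kept vertex only makes the left-hand sum smaller, so subadditivity
  suffices.\<close>

lemma potential_update:
  assumes "finite V" and V: "V \<subseteq> H \<inter> {a..b}" and "poa_infeasible \<delta> V z \<noteq> {}"
  shows "(\<Sum>v\<in>(V - poa_infeasible \<delta> V z) \<union> (poa_new_vertices \<delta> V z \<inter> H \<inter> {a..b}).
            poa_weight a \<delta> v) < (\<Sum>v\<in>V. poa_weight a \<delta> v)"
proof -
  define I where "I = poa_infeasible \<delta> V z"
  define N where "N = poa_new_vertices \<delta> V z \<inter> H \<inter> {a..b}"
  \<comment> \<open>A superset of the surviving children of \<open>s\<close>; membership in the box
    provides \<open>a $ i \<le> z $ i\<close>, from which the 1-norm of a child is computed.\<close>
  define C where "C s = (\<lambda>i. replace_comp i s z) ` UNIV \<inter> {a..b}" for s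
  have I: "I \<subseteq> V" "finite I"
    using assms(1) by (auto simp: I_def poa_infeasible_def)
  have N: "finite N"
    using finite_new_vertices[OF assms(1)] by (simp add: N_def)
  have child: "(\<Sum>v\<in>C s. poa_weight a \<delta> v) < poa_weight a \<delta> s" if "s \<in> I" for s
  proof -
    have "CARD('n) * poa_weight a \<delta> v < poa_weight a \<delta> s" if "v \<in> C s" for v
    proof (rule poa_weight_child[OF delta_pos])
      from that obtain i where v: "v = replace_comp i s z" "a \<le> v"
        by (auto simp: C_def)
      then have "a $ i \<le> z $ i"
        by (auto simp: less_eq_vec_def dest: spec[of _ i])
      moreover have "a \<le> s"
        using V I \<open>s \<in> I\<close> by auto
      moreover have "z $ i + \<delta> < s $ i"
        using infeasibleD(2) \<open>s \<in> I\<close> by (simp add: I_def)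
      ultimately show "norm1 (v - a) \<le> norm1 (s - a) - \<delta>"
        by (simp add: v norm1_replace_comp)
    qed
    then have "poa_weight a \<delta> v * CARD('n) \<le> poa_weight a \<delta> s - 1" if "v \<in> C s" for v
      using that by (metis Suc_pred' less_Suc_eq_le mult.commute poa_weight_pos)
    then have "poa_weight a \<delta> v \<le> (poa_weight a \<delta> s - 1) div CARD('n)" if "v \<in> C s" for v
      using that by (simp add: less_eq_div_iff_mult_less_eq)
    then have "(\<Sum>v\<in>C s. poa_weight a \<delta> v) \<le> card (C s) * ((poa_weight a \<delta> s - 1) div CARD('n))"
      using sum_bounded_above[of "C s" "poa_weight a \<delta>"] by simp
    also have "card (C s) \<le> CARD('n)"
      unfolding C_def by (meson card_image_le card_mono finite finite_imageI inf_le1 order_trans)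
    then have "card (C s) * ((poa_weight a \<delta> s - 1) div CARD('n))
        \<le> CARD('n) * ((poa_weight a \<delta> s - 1) div CARD('n))"
      by simp
    also have "\<dots> \<le> poa_weight a \<delta> s - 1"
      by simp
    also have "\<dots> < poa_weight a \<delta> s"
      using poa_weight_pos[of a \<delta> s] by simp
    finally show ?thesis .
  qed
  have "N \<subseteq> (\<Union>s\<in>I. C s)"
    by (auto simp: N_def C_def I_def new_vertices_eq)
  then have "(\<Sum>v\<in>N. poa_weight a \<delta> v) \<le> (\<Sum>v\<in>(\<Union>s\<in>I. C s). poa_weight a \<delta> v)"
    using I by (intro sum_mono2) (auto simp: C_def)
  also have "\<dots> \<le> (\<Sum>s\<in>I. \<Sum>v\<in>C s. poa_weight a \<delta> v)"
    using I by (intro sum_UN_le) (auto simp: C_def)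
  also have "\<dots> < (\<Sum>s\<in>I. poa_weight a \<delta> s)"
    using child I assms(3) by (intro sum_strict_mono) (auto simp: I_def)
  finally have "(\<Sum>v\<in>V - I. poa_weight a \<delta> v) + (\<Sum>v\<in>N. poa_weight a \<delta> v)
      < (\<Sum>v\<in>V - I. poa_weight a \<delta> v) + (\<Sum>s\<in>I. poa_weight a \<delta> s)"
    by simp
  also have "\<dots> = (\<Sum>v\<in>V. poa_weight a \<delta> v)"
    using I assms(1) by (simp add: sum.subset_diff)
  moreover have "(\<Sum>v\<in>(V - I) \<union> N. poa_weight a \<delta> v)
      \<le> (\<Sum>v\<in>V - I. poa_weight a \<delta> v) + (\<Sum>v\<in>N. poa_weight a \<delta> v)"
    using N assms(1) by (subst sum_Un_nat) auto
  ultimately show ?thesis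
    unfolding I_def N_def by linarith
qed

section \<open>One iteration of the loop\<close>

lemma step:
  assumes inv: "invariant s" and "poa_step f G H a b \<epsilon> \<delta> s s'"
  shows "invariant s'" and "potential s' < potential s"
proof -
  obtain x where x: "is_arg_max f (\<lambda>v. v \<in> vertices s) x"
    and s': "s' = poa_update f G H a b \<epsilon> \<delta> x s"
    using assms(2) by (auto simp: poa_step_def)
  define V where "V = vertices s"
  define z where "z = poa_point G a \<delta> x"
  define c where "c = poa_candidate b \<delta> z"
  define improve where "improve \<longleftrightarrow> ereal (f c) > incumbent_value s \<and> c \<in> H \<inter> {a..b}"
  define val where "val = (if improve then ereal (f c) else incumbent_value s)"
  define U where "U = (V - poa_infeasible \<delta> V z) \<union> (poa_new_vertices \<delta> V z \<inter> H \<inter> {a..b})"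
  have s'_eq: "s' = \<lparr>vertices = {v \<in> U. ereal (f v) \<ge> val + ereal \<epsilon>},
      incumbent = (if improve then Some c else incumbent s), incumbent_value = val\<rparr>"
    unfolding s' poa_update_def Let_def U_def val_def improve_def c_def z_def V_def by simp
  have V: "finite V" "V \<subseteq> H \<inter> {a..b}" "\<forall>u\<in>V. \<forall>v\<in>V. u \<le> v \<longrightarrow> u = v"
    and cover: "\<And>w. w \<in> feasible (relaxed \<delta> G) H a b \<Longrightarrow>
        (\<exists>v\<in>V. w \<le> v) \<or> ereal (f w) < incumbent_value s + ereal \<epsilon>"
    and inc: "case incumbent s of None \<Rightarrow> incumbent_value s = - \<infinity>
        | Some z \<Rightarrow> z \<in> feasible G H a b \<and> incumbent_value s = ereal (f z)"
    using inv by (auto simp: invariant_def V_def)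
  have x: "x \<in> V" and x_max: "\<And>v. v \<in> V \<Longrightarrow> f v \<le> f x"
    using x by (auto simp: is_arg_max_def V_def not_less)
  have xH: "x \<in> H" "a \<le> x" "x \<le> b"
    using V(2) x by auto
  obtain \<tau> where tau: "0 \<le> \<tau>" "z = x - \<tau> *\<^sub>R 1" and zG: "z + \<delta> *\<^sub>R 1 \<in> G"
    and z_max: "\<tau> = 0 \<or> (\<forall>w\<in>relaxed \<delta> G. \<exists>i. w $ i \<le> z $ i)"
    using poa_point_cases[OF xH(2)] unfolding z_def by metis
  have cG: "c \<in> G"
    by (rule in_GI[OF zG]) (simp add: c_def poa_candidate_def less_eq_vec_def)
  have val_ge: "incumbent_value s \<le> val"
    by (auto simp: val_def improve_def)
  have U_le: "\<exists>u\<in>V. v \<le> u" if "v \<in> U" for v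
    using that infeasibleD(1,6) by (fastforce simp: U_def new_vertices_eq)
  \<comment> \<open>Adding \<delta> makes up for the shift by \<tau>, so \<open>c\<close> lies
    between \<open>x\<close> and \<open>b\<close> and inherits membership in \<open>H\<close> from
    \<open>x\<close>. As \<open>x\<close> maximises \<open>f\<close> on \<open>V\<close>, no point
    under a vertex has a value above \<open>val\<close>.\<close>
  have below: "ereal (f w) < val + ereal \<epsilon>" if "\<tau> \<le> \<delta>" "v \<in> V" "w \<le> v" for v w
  proof -
    have "x \<le> c"
      using tau that xH(3) by (simp add: c_def poa_candidate_def less_eq_vec_def)
    moreover have "c \<le> b"
      by (simp add: c_def poa_candidate_def less_eq_vec_def)
    ultimately have "c \<in> H \<inter> {a..b}"
      using xH in_HI by auto
    then have "ereal (f c) \<le> val"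
      by (auto simp: val_def improve_def)
    moreover have "f w \<le> f c"
      using x_max[OF that(2)] monoD[OF mono_f that(3)] monoD[OF mono_f \<open>x \<le> c\<close>] by linarith
    ultimately have "ereal (f w) \<le> val"
      by (meson ereal_less_eq(3) order_trans)
    then show ?thesis
      using eps_pos by (cases val) auto
  qed
  have U: "finite U" "U \<subseteq> H \<inter> {a..b}"
    using V finite_new_vertices[OF V(1)] by (auto simp: U_def)
  have anti: "u = v" if "u \<in> U" "v \<in> U" "u \<le> v" for u v
    using antichain_update[OF V(3), of u z v] that by (auto simp: U_def)
  have cover': "(\<exists>v\<in>vertices s'. w \<le> v) \<or> ereal (f w) < val + ereal \<epsilon>"
    if w: "w \<in> feasible (relaxed \<delta> G) H a b" for w
  proof (cases "\<exists>v\<in>V. w \<le> v")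
    case False
    with cover[OF w] show ?thesis
      using val_ge by (meson add_right_mono order_less_le_trans)
  next
    case True
    show ?thesis
    \<comment> \<open>For \<tau> = 0 the fact \<open>z_max\<close> yields no component bound, but
      then \<open>below\<close> applies to \<open>w\<close> directly.\<close>
    proof (cases "\<tau> = 0")
      case True
      with below \<open>\<exists>v\<in>V. w \<le> v\<close> delta_pos show ?thesis
        by auto
    next
      case False
      then obtain i where "w $ i \<le> z $ i"
        using z_max w by (auto simp: feasible_def)
      then obtain v where v: "v \<in> U" "w \<le> v"
        using cover_update[OF V, of w i z] w \<open>\<exists>v\<in>V. w \<le> v\<close>
        unfolding feasible_def U_def by fastforce
      show ?thesis
      proof (cases "val + ereal \<epsilon> \<le> ereal (f v)")
        case True
        with v show ?thesis
          by (auto simp: s'_eq)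
      next
        case False
        with monoD[OF mono_f v(2)] show ?thesis
          by (meson ereal_less_eq(3) not_le order_le_less_trans)
      qed
    qed
  qed
  show "invariant s'"
    unfolding invariant_def
  proof (intro conjI)
    show "finite (vertices s')" "vertices s' \<subseteq> H \<inter> {a..b}"
      using U by (auto simp: s'_eq)
    show "\<forall>u\<in>vertices s'. \<forall>v\<in>vertices s'. u \<le> v \<longrightarrow> u = v"
      using anti by (auto simp: s'_eq)
    show "\<forall>x\<in>feasible (relaxed \<delta> G) H a b.
       (\<exists>v\<in>vertices s'. x \<le> v) \<or> ereal (f x) < incumbent_value s' + ereal \<epsilon>"
      using cover' by (simp add: s'_eq)
    show "case incumbent s' of None \<Rightarrow> incumbent_value s' = - \<infinity>
        | Some z \<Rightarrow> z \<in> feasible G H a b \<and> incumbent_value s' = ereal (f z)"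
      using inc cG by (auto simp: s'_eq val_def improve_def feasible_def split: option.splits)
  qed
  show "potential s' < potential s"
  proof (cases "\<tau> \<le> \<delta>")
    case True
    \<comment> \<open>Every point of \<open>U\<close> lies under an old vertex, so
      \<open>below\<close> prunes it; the strict drop then comes from the positive weight of
      \<open>x\<close>.\<close>
    then have "vertices s' = {}"
      using below U_le by (force simp: s'_eq)
    moreover have "0 < (\<Sum>v\<in>V. poa_weight a \<delta> v)"
      using x V(1) by (intro sum_pos) (auto intro: poa_weight_pos)
    ultimately show ?thesis
      by (simp add: potential_def V_def)
  next
    case False
    \<comment> \<open>Now \<open>x\<close> exceeds \<open>z\<close> by \<tau> > \<delta> in every
      component, so at least one vertex is replaced.\<close>
    then have "x \<in> poa_infeasible \<delta> V z"
      using x tau by (simp add: poa_infeasible_def strictly_below_def)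
    then have "(\<Sum>v\<in>U. poa_weight a \<delta> v) < potential s"
      using potential_update[OF V(1,2), of z] by (auto simp: U_def potential_def V_def)
    moreover have "potential s' \<le> (\<Sum>v\<in>U. poa_weight a \<delta> v)"
      unfolding potential_def using U(1) by (intro sum_mono2) (auto simp: s'_eq)
    ultimately show ?thesis
      by simp
  qed
qed

section \<open>Runs of the algorithm\<close>

text \<open>The potential is a natural number, so its strict decrease pays one unit for each
  iteration counted by \<open>k\<close>.\<close>

lemma reaches:
  assumes "poa_reaches f G H a b \<epsilon> \<delta> k s"
  shows "invariant s \<and> k + potential s \<le> potential (poa_init b)"
  using assms
proof (induction k arbitrary: s)
  case 0
  then show ?case
    using invariant_init by (auto simp: poa_reaches_def)
next
  case (Suc k)
  then obtain s0 where "poa_reaches f G H a b \<epsilon> \<delta> k s0" and s0: "poa_step f G H a b \<epsilon> \<delta> s0 s"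
    by (auto simp: poa_reaches_def)
  with Suc.IH have "invariant s0" "k + potential s0 \<le> potential (poa_init b)"
    by auto
  with step[OF _ s0] show ?case
    by auto
qed

lemma step_exists:
  assumes "invariant s" and "vertices s \<noteq> {}"
  shows "\<exists>s'. poa_step f G H a b \<epsilon> \<delta> s s'"
proof -
  have "finite (vertices s)"
    using assms(1) by (simp add: invariant_def)
  then show ?thesis
    using finite_is_arg_max[of "vertices s" f] assms(2) by (auto simp: poa_step_def)
qed

text \<open>Without vertices only the value bound of the covering clause is left. For an incumbent
  it is the optimality condition; for the value \<open>- \<infinity>\<close> it is impossible, so no
  relaxed feasible point exists.\<close>

lemma final_state:
  assumes "invariant s" and "vertices s = {}"
  shows "case incumbent s of None \<Rightarrow> feasible (relaxed \<delta> G) H a b = {}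
    | Some z \<Rightarrow> relaxed_optimal f G H a b \<epsilon> \<delta> z"
  using assms by (auto simp: invariant_def relaxed_optimal_def split: option.splits)

end

text \<open>The bound on \<open>k\<close> excludes infinite runs and the second conjunct excludes
  runs that block with vertices left, so every run ends in a state described by the third.\<close>

theorem theorem2:
  fixes a b :: "real ^ 'n" and f :: "real ^ 'n \<Rightarrow> real" and G H :: "(real ^ 'n) set"
    and \<epsilon> \<delta> :: real and D :: nat
  assumes "CARD('n) \<ge> 2"
    and "a \<le> b"
    and "mono f"
    and "closed G" and "normal_set G" and "a \<in> G"
    and "closed H" and "conormal_set H" and "b \<in> H"
    and "\<epsilon> > 0" and "\<delta> > 0"
    and "D = nat \<lfloor>norm1 (b - a) / \<delta>\<rfloor> + 1"
  shows "(\<forall>k s. poa_reaches f G H a b \<epsilon> \<delta> k s \<longrightarrow>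
             real k \<le> (real CARD('n) ^ D - 1) / (real CARD('n) - 1))
       \<and> (\<forall>k s. poa_reaches f G H a b \<epsilon> \<delta> k s \<and> vertices s \<noteq> {} \<longrightarrow>
             (\<exists>s'. poa_step f G H a b \<epsilon> \<delta> s s'))
       \<and> (\<forall>k s. poa_reaches f G H a b \<epsilon> \<delta> k s \<and> vertices s = {} \<longrightarrow>
             (case incumbent s of
                None \<Rightarrow> feasible (relaxed \<delta> G) H a b = {}
              | Some z \<Rightarrow> relaxed_optimal f G H a b \<epsilon> \<delta> z))"
proof -
  interpret poa a b f G H \<epsilon> \<delta>
    using assms by unfold_locales
  \<comment> \<open>The \<open>Suc\<close> in \<open>poa_weight\<close> matches the
    \<open>+ 1\<close> in \<open>D\<close>, so the single initial vertex contributes exactly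
    \<open>D\<close> powers.\<close>
  have "real (potential (poa_init b)) = (\<Sum>j<D. real CARD('n) ^ j)"
    by (simp add: potential_def poa_init_def poa_weight_def assms(12))
  also have "\<dots> = (real CARD('n) ^ D - 1) / (real CARD('n) - 1)"
    using assms(1) by (intro geometric_sum) auto
  finally have bound: "real k \<le> (real CARD('n) ^ D - 1) / (real CARD('n) - 1)"
    if "k \<le> potential (poa_init b)" for k
    using that by (metis of_nat_le_iff)
  show ?thesis
    using reaches bound step_exists final_state by (meson add_leD1)
qed

end
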